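(* The function $$L(X,\mathbf p)=\Big[(AXA'+Q)^{-1}+\sum_{i=1}^m p_i\frac{C_i'C_i}{r_i}\Big]^{-1},$$ defined for symmetric positive semidefinite $X\in\mathbb R^{n\times n}$ and $\mathbf p=[p_1,\dots,p_m]'\in\mathbb R^m$ with $p_i\ge0$, is convex with respect to $\mathbf p$ (for each fixed $X$), and is concave and monotonically increasing with respect to $X$ (for each fixed $\mathbf p$). Convexity, concavity and monotonicity of matrix-valued functions are with respect to the Loewner (positive semidefinite) order.
   Context: $A\in\mathbb R^{n\times n}$; $Q\in\mathbb R^{n\times n}$ is symmetric positive definite; $C_1,\dots,C_m\in\mathbb R^{1\times n}$ are row vectors with $C=[C_1',\dots,C_m']'$ and $(C,A)$ observable; $r_1,\dots,r_m>0$. Prime denotes transpose. "Monotonically increasing" means $X\le Y$ implies $L(X,\mathbf p)\le L(Y,\mathbf p)$. *)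

theory Defs
  imports "HOL-Analysis.Analysis"
begin

definition symmetric_matrix :: "real^'n^'n \<Rightarrow> bool" where
  "symmetric_matrix X \<longleftrightarrow> transpose X = X"

definition pos_semidef :: "real^'n^'n \<Rightarrow> bool" where
  "pos_semidef X \<longleftrightarrow> symmetric_matrix X \<and> (\<forall>x. 0 \<le> x \<bullet> (X *v x))"

definition pos_def :: "real^'n^'n \<Rightarrow> bool" where
  "pos_def X \<longleftrightarrow> symmetric_matrix X \<and> (\<forall>x. x \<noteq> 0 \<longrightarrow> 0 < x \<bullet> (X *v x))"

(* The order on vec in the library is componentwise, hence a separate relation. *)
definition loewner_le :: "real^'n^'n \<Rightarrow> real^'n^'n \<Rightarrow> bool" where
  "loewner_le X Y \<longleftrightarrow> pos_semidef (Y - X)"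

definition loewner_convex_on :: "'a::real_vector set \<Rightarrow> ('a \<Rightarrow> real^'n^'n) \<Rightarrow> bool" where
  "loewner_convex_on S f \<longleftrightarrow> convex S \<and>
    (\<forall>x\<in>S. \<forall>y\<in>S. \<forall>u\<ge>0. \<forall>v\<ge>0. u + v = 1 \<longrightarrow>
      loewner_le (f (u *\<^sub>R x + v *\<^sub>R y)) (u *\<^sub>R f x + v *\<^sub>R f y))"

definition loewner_concave_on :: "'a::real_vector set \<Rightarrow> ('a \<Rightarrow> real^'n^'n) \<Rightarrow> bool" where
  "loewner_concave_on S f \<longleftrightarrow> convex S \<and>
    (\<forall>x\<in>S. \<forall>y\<in>S. \<forall>u\<ge>0. \<forall>v\<ge>0. u + v = 1 \<longrightarrow>
      loewner_le (u *\<^sub>R f x + v *\<^sub>R f y) (f (u *\<^sub>R x + v *\<^sub>R y)))"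

(* The initial state of x(k+1) = A x(k), y(k) = C x(k) is determined by its outputs. *)
definition observable :: "real^'n^'m \<Rightarrow> real^'n^'n \<Rightarrow> bool" where
  "observable C A \<longleftrightarrow>
    (\<forall>x y. (\<forall>k. C *v (((*v) A ^^ k) x) = C *v (((*v) A ^^ k) y)) \<longrightarrow> x = y)"

definition row_mat :: "real^'n^'m \<Rightarrow> 'm \<Rightarrow> real^'n^1" where
  "row_mat C i = rowvector (row i C)"

definition info_mat :: "real^'n^'m \<Rightarrow> ('m \<Rightarrow> real) \<Rightarrow> real^'m \<Rightarrow> real^'n^'n" where
  "info_mat C r p =
    (\<Sum>i\<in>UNIV. p $ i *\<^sub>R ((1 / r i) *\<^sub>R (transpose (row_mat C i) ** row_mat C i)))"

(* matrix_inv is unspecified on singular matrices; the lemma riccati_map_defined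
   shows that both inverses exist on the domain of interest. *)
definition riccati_map ::
    "real^'n^'n \<Rightarrow> real^'n^'n \<Rightarrow> real^'n^'m \<Rightarrow> ('m \<Rightarrow> real) \<Rightarrow>
     real^'n^'n \<Rightarrow> real^'m \<Rightarrow> real^'n^'n" where
  "riccati_map A Q C r X p =
    matrix_inv (matrix_inv (A ** X ** transpose A + Q) + info_mat C r p)"

lemma pos_def_invertible:
  assumes "pos_def X" shows "invertible X"
proof -
  have "x = 0" if "X *v x = 0" for x
    using assms that unfolding pos_def_def by force
  then show ?thesis
    using invertible_left_inverse matrix_left_invertible_ker by blast
qed

lemma pos_def_matrix_inv:
  assumes "pos_def X" shows "pos_def (matrix_inv X)"
proof -
  let ?Y = "matrix_inv X"
  have inv: "X ** ?Y = mat 1" "?Y ** X = mat 1"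
    using someI_ex[OF pos_def_invertible[OF assms, unfolded invertible_def]]
    by (auto simp: matrix_inv_def)
  have tX: "transpose X = X"
    using assms by (simp add: pos_def_def symmetric_matrix_def)
  have "transpose ?Y ** X = mat 1"
    by (metis inv(1) matrix_transpose_mul tX transpose_mat)
  then have sym: "transpose ?Y = ?Y"
    by (metis inv(1) matrix_mul_assoc matrix_mul_lid matrix_mul_rid)
  have "0 < x \<bullet> (?Y *v x)" if "x \<noteq> 0" for x
  proof -
    have x: "X *v (?Y *v x) = x"
      by (simp add: matrix_vector_mul_assoc inv)
    then have "?Y *v x \<noteq> 0"
      using that by force
    then have "0 < (?Y *v x) \<bullet> (X *v (?Y *v x))"
      using assms by (simp add: pos_def_def)
    then show ?thesis
      by (simp add: x inner_commute)
  qed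
  then show ?thesis
    using sym by (simp add: pos_def_def symmetric_matrix_def)
qed

lemma pos_def_add_pos_semidef:
  assumes "pos_def X" "pos_semidef Y" shows "pos_def (X + Y)"
  using assms
  by (auto simp: pos_def_def pos_semidef_def symmetric_matrix_def transpose_def vec_eq_iff
      matrix_vector_mult_add_rdistrib inner_add_right add_pos_nonneg)

lemma pos_semidef_congruence:
  fixes B :: "real^'n^'m"
  assumes "pos_semidef X" shows "pos_semidef (B ** X ** transpose B)"
proof -
  have "x \<bullet> ((B ** X ** transpose B) *v x) = (transpose B *v x) \<bullet> (X *v (transpose B *v x))" for x
    by (simp add: matrix_vector_mul_assoc[symmetric] dot_lmul_matrix[symmetric])
  then show ?thesis
    using assms
    by (simp add: pos_semidef_def symmetric_matrix_def matrix_transpose_mul matrix_mul_assoc)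
qed

lemma pos_semidef_info_mat:
  assumes "\<And>i. 0 < r i" "\<And>i. 0 \<le> p $ i"
  shows "pos_semidef (info_mat C r p)"
proof -
  have gram: "pos_semidef (transpose (row_mat C i) ** row_mat C i)" for i
    using pos_semidef_congruence[of "mat 1" "transpose (row_mat C i)"]
    by (simp add: pos_semidef_def symmetric_matrix_def)
  have scale: "pos_semidef (c *\<^sub>R X)" if "0 \<le> c" "pos_semidef X" for c and X :: "real^'n^'n"
    using that by (auto simp: pos_semidef_def symmetric_matrix_def transpose_scalar
      scaleR_matrix_vector_assoc[symmetric])
  have add: "pos_semidef (X + Y)" if "pos_semidef X" "pos_semidef Y" for X Y :: "real^'n^'n"
    using that by (auto simp: pos_semidef_def symmetric_matrix_def transpose_def vec_eq_iff
      matrix_vector_mult_add_rdistrib inner_add_right)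
  have "pos_semidef (\<Sum>i\<in>F. p $ i *\<^sub>R ((1 / r i) *\<^sub>R (transpose (row_mat C i) ** row_mat C i)))"
    if "finite F" for F
    using that
  proof induction
    case empty
    then show ?case
      by (simp add: pos_semidef_def symmetric_matrix_def transpose_def vec_eq_iff)
  next
    case (insert i F)
    then show ?case
      using assms by (simp add: add scale gram less_imp_le)
  qed
  then show ?thesis
    by (simp add: info_mat_def)
qed

lemma riccati_map_defined:
  assumes "pos_def Q" "\<And>i. 0 < r i" "pos_semidef X" "\<And>i. 0 \<le> p $ i"
  shows "invertible (A ** X ** transpose A + Q)"
    and "invertible (matrix_inv (A ** X ** transpose A + Q) + info_mat C r p)"
proof -
  have *: "pos_def (A ** X ** transpose A + Q)"
    using pos_def_add_pos_semidef[OF assms(1) pos_semidef_congruence[OF assms(3), of A]]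
    by (simp add: add.commute)
  then show "invertible (A ** X ** transpose A + Q)"
    by (rule pos_def_invertible)
  show "invertible (matrix_inv (A ** X ** transpose A + Q) + info_mat C r p)"
    using pos_def_invertible pos_def_add_pos_semidef pos_def_matrix_inv[OF *]
      pos_semidef_info_mat assms by blast
qed

end

theory Submission
  imports Defs
begin

text \<open>
  Both halves rest on writing the quadratic form of an inverse as an extremum of functions that
  are affine in the matrix argument.

  For positive definite \<open>M\<close>, completing the square shows that \<open>x \<bullet> M\<^sup>-\<^sup>1 x\<close> is the maximum over \<open>y\<close>
  of \<open>2 (x \<bullet> y) - y \<bullet> M y\<close>. A pointwise maximum of affine functions of \<open>M\<close> is convex, so matrix
  inversion is convex in the Loewner order, and \<open>L(X, p)\<close> is the inverse of a matrix that is
  affine in \<open>p\<close>.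

  For positive definite \<open>P\<close> and positive semidefinite \<open>S\<close>, the form of \<open>(P\<^sup>-\<^sup>1 + S)\<^sup>-\<^sup>1\<close> at \<open>x\<close> is
  the minimum over \<open>y\<close> of \<open>(x - S y) \<bullet> P (x - S y) + y \<bullet> S y\<close>. This is the optimality of the
  Kalman gain: the updated error covariance is the least one among all linear corrections of the
  estimate. As each competitor is affine and increasing in \<open>P\<close>, the minimum is concave and
  increasing in \<open>P\<close>, and \<open>P = A X A' + Q\<close> is affine and increasing in \<open>X\<close>. The usual form of
  the principle speaks of \<open>C\<close> and the noise variances \<open>r i / p i\<close>, which break down when a weight
  vanishes; the form in terms of the information \<open>S\<close> contains no inverse of a weight.
\<close>

section \<open>Quadratic forms and the Loewner order\<close>

lemma symmetric_matrix_inner: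
  fixes M :: "real^'n^'n"
  assumes "symmetric_matrix M" shows "x \<bullet> (M *v y) = (M *v x) \<bullet> y"
  using assms by (metis dot_lmul_matrix symmetric_matrix_def transpose_matrix_vector)

lemma symmetric_matrix_add:
  "symmetric_matrix M \<Longrightarrow> symmetric_matrix N \<Longrightarrow> symmetric_matrix (M + N)"
  by (simp add: symmetric_matrix_def transpose_def vec_eq_iff)

lemma symmetric_matrix_scaleR: "symmetric_matrix M \<Longrightarrow> symmetric_matrix (c *\<^sub>R M)"
  by (simp add: symmetric_matrix_def transpose_def vec_eq_iff)

lemma quadratic_form_combination:
  fixes M N :: "real^'n^'n"
  shows "x \<bullet> ((u *\<^sub>R M + v *\<^sub>R N) *v x) = u * (x \<bullet> (M *v x)) + v * (x \<bullet> (N *v x))"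
  by (simp add: matrix_vector_mult_add_rdistrib scaleR_matrix_vector_assoc[symmetric]
      inner_add_right)

lemma loewner_leI:
  assumes "symmetric_matrix X" "symmetric_matrix Y"
    and "\<And>x. x \<bullet> (X *v x) \<le> x \<bullet> (Y *v x)"
  shows "loewner_le X Y"
  using assms
  by (simp add: loewner_le_def pos_semidef_def symmetric_matrix_def transpose_def vec_eq_iff
      matrix_vector_mult_diff_rdistrib inner_diff_right)

lemma loewner_leD: "loewner_le X Y \<Longrightarrow> x \<bullet> (X *v x) \<le> x \<bullet> (Y *v x)"
  by (simp add: loewner_le_def pos_semidef_def matrix_vector_mult_diff_rdistrib inner_diff_right)

lemma pos_semidef_combination:
  assumes "pos_semidef M" "pos_semidef N" "0 \<le> u" "0 \<le> v"
  shows "pos_semidef (u *\<^sub>R M + v *\<^sub>R N)"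
  using assms
  by (simp add: pos_semidef_def symmetric_matrix_add symmetric_matrix_scaleR
      quadratic_form_combination)

lemma pos_def_convex_combination:
  assumes "pos_def M" "pos_def N" "0 \<le> u" "0 \<le> v" "u + v = 1"
  shows "pos_def (u *\<^sub>R M + v *\<^sub>R N)"
proof -
  have "0 < u * (x \<bullet> (M *v x)) + v * (x \<bullet> (N *v x))" if "x \<noteq> 0" for x
  proof -
    have M: "0 < x \<bullet> (M *v x)" and N: "0 < x \<bullet> (N *v x)"
      using assms(1,2) that by (auto simp: pos_def_def)
    show ?thesis
    proof (cases "u = 0")
      case True
      then show ?thesis using assms N by simp
    next
      case False
      then show ?thesis using assms M N by (intro add_pos_nonneg) auto
    qed
  qed
  then show ?thesis
    using assms
    by (simp add: pos_def_def symmetric_matrix_add symmetric_matrix_scaleR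
        quadratic_form_combination)
qed

lemma pos_def_symmetric: "pos_def M \<Longrightarrow> symmetric_matrix M"
  by (simp add: pos_def_def)

lemma pos_def_imp_pos_semidef: "pos_def M \<Longrightarrow> pos_semidef M"
  unfolding pos_def_def pos_semidef_def
  by (metis inner_zero_left less_eq_real_def)

lemma matrix_inv_mult_vector:
  fixes M :: "real^'n^'n"
  assumes "pos_def M"
  shows "M *v (matrix_inv M *v x) = x" and "matrix_inv M *v (M *v x) = x"
proof -
  have "M ** matrix_inv M = mat 1 \<and> matrix_inv M ** M = mat 1"
    using someI_ex[OF pos_def_invertible[OF assms, unfolded invertible_def]]
    by (simp add: matrix_inv_def)
  then show "M *v (matrix_inv M *v x) = x" "matrix_inv M *v (M *v x) = x"
    by (simp_all add: matrix_vector_mul_assoc)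
qed

section \<open>Convexity of matrix inversion\<close>

text \<open>
  The gap between the two sides is the form of \<open>M\<close> at \<open>M\<^sup>-\<^sup>1 x - y\<close>, so there is equality for
  \<open>y = M\<^sup>-\<^sup>1 x\<close>.
\<close>

lemma quadratic_form_inverse_ge:
  fixes M :: "real^'n^'n"
  assumes "pos_def M"
  shows "2 * (x \<bullet> y) - y \<bullet> (M *v y) \<le> x \<bullet> (matrix_inv M *v x)"
proof -
  define z where "z = matrix_inv M *v x"
  have x: "M *v z = x"
    by (simp add: z_def matrix_inv_mult_vector[OF assms])
  have "0 \<le> (z - y) \<bullet> (M *v (z - y))"
    using pos_def_imp_pos_semidef[OF assms] by (simp add: pos_semidef_def)
  also have "\<dots> = x \<bullet> z - 2 * (x \<bullet> y) + y \<bullet> (M *v y)"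
    using symmetric_matrix_inner[OF pos_def_symmetric[OF assms], of z y]
    by (simp add: matrix_vector_mult_diff_distrib inner_diff_left inner_diff_right x inner_commute)
  finally show ?thesis
    by (simp add: z_def)
qed

lemma matrix_inv_loewner_convex:
  fixes M N :: "real^'n^'n"
  assumes M: "pos_def M" and N: "pos_def N" and uv: "0 \<le> u" "0 \<le> v" "u + v = 1"
  shows "loewner_le (matrix_inv (u *\<^sub>R M + v *\<^sub>R N)) (u *\<^sub>R matrix_inv M + v *\<^sub>R matrix_inv N)"
proof (rule loewner_leI)
  let ?W = "u *\<^sub>R M + v *\<^sub>R N"
  have W: "pos_def ?W"
    by (rule pos_def_convex_combination[OF assms])
  show "symmetric_matrix (matrix_inv ?W)"
    by (intro pos_def_symmetric pos_def_matrix_inv W)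
  show "symmetric_matrix (u *\<^sub>R matrix_inv M + v *\<^sub>R matrix_inv N)"
    by (intro symmetric_matrix_add symmetric_matrix_scaleR pos_def_symmetric pos_def_matrix_inv M N)
  fix x
  \<comment> \<open>The vector that is optimal for the combination competes in the maximum for each of \<open>M\<close> and \<open>N\<close>.\<close>
  define y where "y = matrix_inv ?W *v x"
  have "x \<bullet> (matrix_inv ?W *v x) = 2 * (x \<bullet> y) - y \<bullet> (?W *v y)"
    using matrix_inv_mult_vector(1)[OF W, of x] by (simp add: y_def inner_commute)
  also have "\<dots> = (u + v) * (2 * (x \<bullet> y)) - (u * (y \<bullet> (M *v y)) + v * (y \<bullet> (N *v y)))"
    unfolding quadratic_form_combination uv by simp
  also have "\<dots> = u * (2 * (x \<bullet> y) - y \<bullet> (M *v y)) + v * (2 * (x \<bullet> y) - y \<bullet> (N *v y))"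
    by (simp only: algebra_simps)
  also have "\<dots> \<le> u * (x \<bullet> (matrix_inv M *v x)) + v * (x \<bullet> (matrix_inv N *v x))"
    by (intro add_mono mult_left_mono quadratic_form_inverse_ge M N uv)
  finally show "x \<bullet> (matrix_inv ?W *v x) \<le> x \<bullet> ((u *\<^sub>R matrix_inv M + v *\<^sub>R matrix_inv N) *v x)"
    by (simp add: quadratic_form_combination)
qed

section \<open>The measurement update as a minimum\<close>

text \<open>
  The passage from a prior error covariance \<open>P\<close> to the posterior one, when the measurements
  contribute the information \<open>S\<close>.
\<close>

definition info_update :: "real^'n^'n \<Rightarrow> real^'n^'n \<Rightarrow> real^'n^'n" where
  "info_update S P = matrix_inv (matrix_inv P + S)"

text \<open>
  The form at \<open>x\<close> of the error covariance \<open>(I - K S) P (I - K S)' + K S K'\<close> that belongs to a gain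
  \<open>K\<close>. It depends on the gain only through \<open>y = K' x\<close>.
\<close>

definition gain_cost :: "real^'n^'n \<Rightarrow> real^'n^'n \<Rightarrow> real^'n \<Rightarrow> real^'n \<Rightarrow> real" where
  "gain_cost S P x y = (x - S *v y) \<bullet> (P *v (x - S *v y)) + y \<bullet> (S *v y)"

lemma gain_cost_combination:
  assumes "u + v = 1"
  shows "gain_cost S (u *\<^sub>R P + v *\<^sub>R R) x y = u * gain_cost S P x y + v * gain_cost S R x y"
proof -
  have "y \<bullet> (S *v y) = u * (y \<bullet> (S *v y)) + v * (y \<bullet> (S *v y))"
    using assms by (metis distrib_right mult_1)
  then show ?thesis
    by (simp add: gain_cost_def quadratic_form_combination distrib_left)
qed

lemma pos_def_info_update:
  assumes "pos_def P" "pos_semidef S" shows "pos_def (info_update S P)"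
  unfolding info_update_def
  by (intro pos_def_matrix_inv pos_def_add_pos_semidef assms)

text \<open>
  With \<open>z\<close> the image of \<open>x\<close> under the update, \<open>x\<close> equals \<open>P\<^sup>-\<^sup>1 z + S z\<close>. Substituting this in the
  cost of \<open>y = z - w\<close>, the terms that are linear in \<open>w\<close> cancel.
\<close>

lemma gain_cost_decomposition:
  fixes P S :: "real^'n^'n"
  assumes P: "pos_def P" and S: "pos_semidef S"
  shows "gain_cost S P x (info_update S P *v x - w) =
    x \<bullet> (info_update S P *v x) + ((S *v w) \<bullet> (P *v (S *v w)) + w \<bullet> (S *v w))"
proof -
  define z where "z = info_update S P *v x"
  define g where "g = matrix_inv P *v z"
  have "(matrix_inv P + S) *v z = x"
    unfolding z_def info_update_def
    by (intro matrix_inv_mult_vector pos_def_add_pos_semidef pos_def_matrix_inv P S)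
  then have x: "x = g + S *v z"
    by (simp add: g_def matrix_vector_mult_add_rdistrib)
  have Pg: "P *v g = z"
    by (simp add: g_def matrix_inv_mult_vector[OF P])
  have *: "g \<bullet> (P *v (S *v w)) = z \<bullet> (S *v w)"
    using symmetric_matrix_inner[OF pos_def_symmetric[OF P]] Pg by metis
  have symS: "w \<bullet> (S *v z) = z \<bullet> (S *v w)"
    using S symmetric_matrix_inner[of S w z] by (simp add: pos_semidef_def inner_commute)
  have "x - S *v (z - w) = g + S *v w"
    by (simp add: x matrix_vector_mult_diff_distrib)
  then have "gain_cost S P x (z - w) =
      (g + S *v w) \<bullet> (P *v (g + S *v w)) + (z - w) \<bullet> (S *v (z - w))"
    by (simp add: gain_cost_def)
  also have "\<dots> = (g + S *v z) \<bullet> z + ((S *v w) \<bullet> (P *v (S *v w)) + w \<bullet> (S *v w))"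
    using * symS
    by (simp add: matrix_vector_mult_diff_distrib matrix_vector_right_distrib Pg
        inner_add_left inner_add_right inner_diff_left inner_diff_right inner_commute[of "S *v _" z])
  finally show ?thesis
    unfolding z_def[symmetric] x[symmetric] .
qed

lemma info_update_le_gain_cost:
  assumes P: "pos_def P" and S: "pos_semidef S"
  shows "x \<bullet> (info_update S P *v x) \<le> gain_cost S P x y"
proof -
  have "0 \<le> (S *v w) \<bullet> (P *v (S *v w)) + w \<bullet> (S *v w)" for w
    using pos_def_imp_pos_semidef[OF P] S by (simp add: pos_semidef_def)
  then show ?thesis
    using gain_cost_decomposition[OF assms, of x "info_update S P *v x - y"] by simp
qed

lemma gain_cost_optimal:
  assumes "pos_def P" "pos_semidef S"
  shows "gain_cost S P x (info_update S P *v x) = x \<bullet> (info_update S P *v x)"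
  using gain_cost_decomposition[OF assms, of x 0] by simp

text \<open>
  In both proofs below, the vector \<open>y\<close> that is optimal for the larger side competes in the minimum
  for the smaller side.
\<close>

lemma info_update_loewner_concave:
  assumes P: "pos_def P" and R: "pos_def R" and S: "pos_semidef S"
    and uv: "0 \<le> u" "0 \<le> v" "u + v = 1"
  shows "loewner_le (u *\<^sub>R info_update S P + v *\<^sub>R info_update S R)
    (info_update S (u *\<^sub>R P + v *\<^sub>R R))"
proof (rule loewner_leI)
  let ?W = "u *\<^sub>R P + v *\<^sub>R R"
  have W: "pos_def ?W"
    by (rule pos_def_convex_combination[OF P R uv])
  show "symmetric_matrix (info_update S ?W)"
    by (intro pos_def_symmetric pos_def_info_update W S)
  show "symmetric_matrix (u *\<^sub>R info_update S P + v *\<^sub>R info_update S R)"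
    by (intro symmetric_matrix_add symmetric_matrix_scaleR pos_def_symmetric pos_def_info_update
        P R S)
  fix x
  define y where "y = info_update S ?W *v x"
  have "u * (x \<bullet> (info_update S P *v x)) + v * (x \<bullet> (info_update S R *v x))
      \<le> u * gain_cost S P x y + v * gain_cost S R x y"
    by (intro add_mono mult_left_mono info_update_le_gain_cost P R S uv)
  also have "\<dots> = gain_cost S ?W x y"
    by (rule gain_cost_combination[OF uv(3), symmetric])
  also have "\<dots> = x \<bullet> (info_update S ?W *v x)"
    unfolding y_def by (rule gain_cost_optimal[OF W S])
  finally show "x \<bullet> ((u *\<^sub>R info_update S P + v *\<^sub>R info_update S R) *v x)
      \<le> x \<bullet> (info_update S ?W *v x)"
    by (simp add: quadratic_form_combination)
qed

lemma info_update_loewner_mono: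
  assumes P: "pos_def P" and R: "pos_def R" and S: "pos_semidef S" and le: "loewner_le P R"
  shows "loewner_le (info_update S P) (info_update S R)"
proof (rule loewner_leI)
  show "symmetric_matrix (info_update S P)" "symmetric_matrix (info_update S R)"
    by (intro pos_def_symmetric pos_def_info_update P R S)+
  fix x
  define y where "y = info_update S R *v x"
  have "x \<bullet> (info_update S P *v x) \<le> gain_cost S P x y"
    by (rule info_update_le_gain_cost[OF P S])
  also have "\<dots> \<le> gain_cost S R x y"
    using loewner_leD[OF le] by (simp add: gain_cost_def)
  also have "\<dots> = x \<bullet> (info_update S R *v x)"
    unfolding y_def by (rule gain_cost_optimal[OF R S])
  finally show "x \<bullet> (info_update S P *v x) \<le> x \<bullet> (info_update S R *v x)" .
qed

section \<open>The Riccati map\<close>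

lemma info_mat_combination:
  "info_mat C r (u *\<^sub>R p + v *\<^sub>R q) = u *\<^sub>R info_mat C r p + v *\<^sub>R info_mat C r q"
  by (simp add: info_mat_def scaleR_add_left sum.distrib scaleR_sum_right add_divide_distrib)

lemma congruence_add:
  fixes A X Y :: "real^'n^'n"
  shows "A ** (X + Y) ** transpose A = A ** X ** transpose A + A ** Y ** transpose A"
  by (simp add: matrix_eq matrix_vector_mul_assoc[symmetric] matrix_vector_mult_add_rdistrib
      matrix_vector_right_distrib)

definition prediction :: "real^'n^'n \<Rightarrow> real^'n^'n \<Rightarrow> real^'n^'n \<Rightarrow> real^'n^'n" where
  "prediction A Q X = A ** X ** transpose A + Q"

lemma riccati_map_eq_info_update:
  "riccati_map A Q C r X p = info_update (info_mat C r p) (prediction A Q X)"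
  by (simp add: riccati_map_def info_update_def prediction_def)

lemma pos_def_prediction:
  assumes "pos_def Q" "pos_semidef X" shows "pos_def (prediction A Q X)"
  using pos_def_add_pos_semidef[OF assms(1) pos_semidef_congruence[OF assms(2), of A]]
  by (simp add: prediction_def add.commute)

lemma prediction_combination:
  assumes "u + v = 1"
  shows "prediction A Q (u *\<^sub>R X + v *\<^sub>R Y) = u *\<^sub>R prediction A Q X + v *\<^sub>R prediction A Q Y"
proof -
  have "Q = u *\<^sub>R Q + v *\<^sub>R Q"
    using assms by (metis scaleR_add_left scaleR_one)
  moreover have "A ** (u *\<^sub>R X + v *\<^sub>R Y) ** transpose A =
      u *\<^sub>R (A ** X ** transpose A) + v *\<^sub>R (A ** Y ** transpose A)"
    by (simp add: congruence_add scalar_matrix_assoc matrix_scalar_ac)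
  ultimately show ?thesis
    by (simp add: prediction_def scaleR_add_right algebra_simps)
qed

lemma prediction_mono:
  assumes "loewner_le X Y" shows "loewner_le (prediction A Q X) (prediction A Q Y)"
proof -
  have "A ** X ** transpose A + A ** (Y - X) ** transpose A = A ** Y ** transpose A"
    by (simp flip: congruence_add)
  then have "A ** (Y - X) ** transpose A = A ** Y ** transpose A - A ** X ** transpose A"
    by (metis add_diff_cancel_left')
  then show ?thesis
    using pos_semidef_congruence[of "Y - X" A] assms
    by (simp add: loewner_le_def prediction_def)
qed

lemma convex_pos_semidef: "convex {X :: real^'n^'n. pos_semidef X}"
  by (simp add: convex_def pos_semidef_combination)

lemma riccati_map_convex:
  fixes A Q :: "real^'n^'n" and C :: "real^'n^'m"
  assumes Q: "pos_def Q" and r: "\<And>i. r i > 0" and X: "pos_semidef X"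
  shows "loewner_convex_on {p. \<forall>i. 0 \<le> p $ i} (\<lambda>p. riccati_map A Q C r X p)"
  unfolding loewner_convex_on_def
proof (intro conjI ballI allI impI)
  show "convex {p :: real^'m. \<forall>i. 0 \<le> p $ i}"
    by (simp add: convex_def)
  fix p q :: "real^'m" and u v :: real
  assume p: "p \<in> {p. \<forall>i. 0 \<le> p $ i}" and q: "q \<in> {p. \<forall>i. 0 \<le> p $ i}"
    and uv: "0 \<le> u" "0 \<le> v" "u + v = 1"
  define J where "J = matrix_inv (prediction A Q X)"
  have pd: "pos_def (J + info_mat C r t)" if "t \<in> {p. \<forall>i. 0 \<le> p $ i}" for t
    unfolding J_def
    using that r
    by (intro pos_def_add_pos_semidef pos_def_matrix_inv pos_def_prediction Q X
        pos_semidef_info_mat) auto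
  have "J = u *\<^sub>R J + v *\<^sub>R J"
    using uv(3) by (metis scaleR_add_left scaleR_one)
  then have "J + info_mat C r (u *\<^sub>R p + v *\<^sub>R q) =
      u *\<^sub>R (J + info_mat C r p) + v *\<^sub>R (J + info_mat C r q)"
    by (simp add: info_mat_combination scaleR_add_right algebra_simps)
  then show "loewner_le (riccati_map A Q C r X (u *\<^sub>R p + v *\<^sub>R q))
      (u *\<^sub>R riccati_map A Q C r X p + v *\<^sub>R riccati_map A Q C r X q)"
    using matrix_inv_loewner_convex[OF pd[OF p] pd[OF q] uv]
    by (simp add: riccati_map_eq_info_update info_update_def J_def)
qed

lemma riccati_map_concave:
  assumes Q: "pos_def Q" and r: "\<And>i. r i > 0" and p: "\<And>i. 0 \<le> p $ i"
  shows "loewner_concave_on {X. pos_semidef X} (\<lambda>X. riccati_map A Q C r X p)"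
  by (auto simp: loewner_concave_on_def convex_pos_semidef riccati_map_eq_info_update
      prediction_combination
      intro!: info_update_loewner_concave pos_def_prediction Q pos_semidef_info_mat r p)

lemma riccati_map_mono:
  assumes Q: "pos_def Q" and r: "\<And>i. r i > 0" and p: "\<And>i. 0 \<le> p $ i"
  shows "monotone_on {X. pos_semidef X} loewner_le loewner_le (\<lambda>X. riccati_map A Q C r X p)"
  by (auto simp: riccati_map_eq_info_update
      intro!: monotone_onI info_update_loewner_mono pos_def_prediction Q pos_semidef_info_mat r p
        prediction_mono)

theorem theorem3:
  fixes A Q :: "real^'n^'n"
    and C :: "real^'n^'m"
    and r :: "'m \<Rightarrow> real"
  assumes "pos_def Q"
    and "observable C A"
    and "\<And>i. r i > 0"
  shows "(\<forall>X. pos_semidef X \<longrightarrow>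
            loewner_convex_on {p. \<forall>i. 0 \<le> p $ i} (\<lambda>p. riccati_map A Q C r X p))
       \<and> (\<forall>p. (\<forall>i. 0 \<le> p $ i) \<longrightarrow>
            loewner_concave_on {X. pos_semidef X} (\<lambda>X. riccati_map A Q C r X p)
          \<and> monotone_on {X. pos_semidef X} loewner_le loewner_le (\<lambda>X. riccati_map A Q C r X p))"
  using assms by (simp add: riccati_map_convex riccati_map_concave riccati_map_mono)

end
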